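(* Let $t\geq 0$ be an integer and let $G$ be a $t$-connected graph with $n$ vertices. Then for every integer $k\geq 1$ with $n\geq k+1$, the $k$-token graph $F_k(G)$ is $t$-connected.
   Context: Graphs are finite, simple and undirected. For a graph $G$ and an integer $k\geq 1$, the $k$-token graph $F_k(G)$ is the graph whose vertices are the $k$-element subsets of $V(G)$, where two vertices $A,B$ are adjacent whenever their symmetric difference $A\triangle B$ is a pair $\{a,b\}$ with $a\in A$, $b\in B$ and $ab\in E(G)$. A graph $G$ is $t$-connected if $|V(G)|>t$ and $G-X$ is connected for every $X\subseteq V(G)$ with $|X|<t$. *)

theory Defs
  imports "Graph_Theory.Digraph_Component"
begin

text \<open>Simple undirected graphs are symmetric digraphs (the locale predicate \<^const>\<open>graph\<close>):
  an edge \<open>ab\<close> is present iff \<open>a\<close> dominates \<open>b\<close>, and it is represented by the two arcs between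
  \<open>a\<close> and \<open>b\<close>. The same encoding is used for token graphs; since \<open>G\<close> has no loops, \<open>a\<close> and \<open>b\<close>
  below are distinct, so that \<open>{a, b}\<close> really is a pair.\<close>

definition token_graph ::
    "nat \<Rightarrow> ('a, 'b) pre_digraph \<Rightarrow> ('a set, 'a set \<times> 'a set) pre_digraph" where
  "token_graph k G =
    \<lparr>verts = {A. A \<subseteq> verts G \<and> card A = k},
     arcs = {(A, B). A \<subseteq> verts G \<and> card A = k \<and> B \<subseteq> verts G \<and> card B = k \<and>
       (\<exists>a\<in>A. \<exists>b\<in>B. sym_diff A B = {a, b} \<and> a \<rightarrow>\<^bsub>G\<^esub> b)},
     tail = fst, head = snd\<rparr>"

text \<open>The library's \<^const>\<open>Digraph_Component.connected\<close> is false for the empty graph. This does not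
  matter here: as \<open>card X < t < card (verts G)\<close>, the graph \<open>G - X\<close> always has a vertex.\<close>

definition t_connected :: "nat \<Rightarrow> ('a, 'b) pre_digraph \<Rightarrow> bool" where
  "t_connected t G \<longleftrightarrow> card (verts G) > t \<and>
    (\<forall>X. X \<subseteq> verts G \<and> card X < t \<longrightarrow> Digraph_Component.connected (G \<restriction> (verts G - X)))"

lemma graph_token_graph:
  assumes "graph G"
  shows "graph (token_graph k G)"
proof -
  interpret graph G by fact
  have fin: "finite {A. A \<subseteq> verts G \<and> card A = k}"
    by (rule finite_subset[of _ "Pow (verts G)"]) auto
  interpret T: wf_digraph "token_graph k G"
    by unfold_locales (auto simp: token_graph_def)
  have sym: "sym (arcs_ends G)"
    using sym_arcs by (simp add: symmetric_def)
  have swap: "(B, A) \<in> arcs (token_graph k G)"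
    if AB: "(A, B) \<in> arcs (token_graph k G)" for A B
  proof -
    have "\<exists>a\<in>A. \<exists>b\<in>B. sym_diff A B = {a, b} \<and> a \<rightarrow>\<^bsub>G\<^esub> b"
      using AB by (simp add: token_graph_def)
    then obtain a b where ab: "a \<in> A" "b \<in> B" "sym_diff A B = {a, b}" "a \<rightarrow>\<^bsub>G\<^esub> b"
      by blast
    have "b \<rightarrow>\<^bsub>G\<^esub> a" using sym ab(4) by (rule symD)
    moreover have "sym_diff B A = {b, a}" using ab(3) by blast
    ultimately have "\<exists>b\<in>B. \<exists>a\<in>A. sym_diff B A = {b, a} \<and> b \<rightarrow>\<^bsub>G\<^esub> a"
      using ab(1,2) by blast
    then show ?thesis using AB by (simp add: token_graph_def)
  qed
  show ?thesis
  proof unfold_locales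
    show "finite (verts (token_graph k G))" using fin by (simp add: token_graph_def)
    show "finite (arcs (token_graph k G))"
      by (rule finite_subset[OF _ finite_cartesian_product[OF fin fin]])
         (auto simp: token_graph_def)
    show "tail (token_graph k G) e \<noteq> head (token_graph k G) e"
      if "e \<in> arcs (token_graph k G)" for e
    proof -
      have "\<exists>a b. sym_diff (fst e) (snd e) = {a, b}"
        using that by (simp add: token_graph_def case_prod_beta) blast
      then have "fst e \<noteq> snd e" by (metis Diff_cancel Un_empty insert_not_empty)
      then show ?thesis by (simp add: token_graph_def)
    qed
    show "e1 = e2" if "arc_to_ends (token_graph k G) e1 = arc_to_ends (token_graph k G) e2" for e1 e2
      using that by (simp add: token_graph_def arc_to_ends_def prod_eq_iff)
    have "tail (token_graph k G) = fst" "head (token_graph k G) = snd"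
      by (simp_all add: token_graph_def)
    then show "symmetric (token_graph k G)"
      using swap unfolding symmetric_def arcs_ends_conv sym_def by (simp add: image_iff)
  qed
qed

end

(* The proof is by induction on t. Let S be a nonempty set of fewer than t token configurations,
   fix X in S, and let A, B be configurations outside S. Choose a vertex v in X - A and a vertex w
   in B - X. The configurations avoiding v form the token graph of G - v, and those containing w
   form the (k-1)-token graph of G - w; neither family contains X, so each loses at most
   card S - 1 configurations and stays connected, G - v and G - w being (t-1)-connected.
   The two families meet in a configuration outside S: they share (n - 2) choose (k - 1) >= n - 2
   configurations, none of which is X (the cases k = 1 and n = k + 1, where the count fails, are
   trivial). This joins A to B. *)

theory Submission
  imports Defs
begin

section \<open>Reachability inside a vertex set and connectivity of induced subgraphs\<close>

text \<open>\<open>rtrancl_on F\<close> already keeps every vertex of a walk in \<open>F\<close>, so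
  pairs of \<open>r\<close> leaving \<open>F\<close> never occur in it.\<close>

lemma rtrancl_on_restrict:
  "rtrancl_on F (r \<inter> F \<times> F) = rtrancl_on F r"
proof
  show "rtrancl_on F (r \<inter> F \<times> F) \<subseteq> rtrancl_on F r"
    by (auto intro: rtrancl_on_mono[of "r \<inter> F \<times> F" r F F])
  show "rtrancl_on F r \<subseteq> rtrancl_on F (r \<inter> F \<times> F)"
  proof clarify
    fix a b assume "(a, b) \<in> rtrancl_on F r"
    then show "(a, b) \<in> rtrancl_on F (r \<inter> F \<times> F)"
      by (induct rule: rtrancl_on_induct) (auto intro: rtrancl_on_into_rtrancl_on)
  qed
qed

text \<open>Serves to put a fixed token back into every configuration of a walk.\<close>

lemma rtrancl_on_map:
  assumes "(a, b) \<in> rtrancl_on F r"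
    and "\<And>x. x \<in> F \<Longrightarrow> f x \<in> H"
    and "\<And>x y. (x, y) \<in> r \<Longrightarrow> x \<in> F \<Longrightarrow> y \<in> F \<Longrightarrow> (f x, f y) \<in> s"
  shows "(f a, f b) \<in> rtrancl_on H s"
  using assms(1)
  by (induct rule: rtrancl_on_induct) (auto intro: rtrancl_on_into_rtrancl_on assms(2,3))

text \<open>The arcs are symmetric, so the symmetric closure in the definition of connectedness adds
  nothing and strong connectivity results. Reachability is then expressed by the arcs of
  \<open>G\<close> itself, with \<open>W\<close> as the only trace of the subgraph.\<close>

lemma connected_induce_subgraph_iff:
  assumes "graph G" and "W \<subseteq> verts G"
  shows "Digraph_Component.connected (G \<restriction> W) \<longleftrightarrow>
    W \<noteq> {} \<and> (\<forall>u\<in>W. \<forall>v\<in>W. (u, v) \<in> rtrancl_on W (arcs_ends G))"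
proof -
  interpret graph G by fact
  interpret W: wf_digraph "G \<restriction> W" by (rule wellformed_induce_subgraph)
  have ends: "arcs_ends (G \<restriction> W) = arcs_ends G \<inter> W \<times> W"
    by (auto simp: arcs_ends_conv)
  have "sym (arcs_ends G)" using sym_arcs by (simp add: symmetric_def)
  then have "symmetric (G \<restriction> W)"
    by (auto simp: symmetric_def ends sym_def)
  then have "Digraph_Component.connected (G \<restriction> W) \<longleftrightarrow> strongly_connected (G \<restriction> W)"
    by (simp add: connected_def strongly_connected_def W.reachable_mk_symmetric_eq)
  then show ?thesis
    by (simp add: strongly_connected_def reachable_def ends rtrancl_on_restrict)
qed

text \<open>By Pascal's rule \<open>Suc n choose k\<close> is the sum of \<open>n choose k\<close>,
  at least \<open>n\<close> by induction when \<open>k < n\<close>, and a positive term;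
  \<open>k = n\<close> gives \<open>Suc n\<close> exactly.\<close>

lemma le_binomial:
  assumes "0 < k" and "k < n"
  shows "n \<le> n choose k"
  using assms
proof (induct n arbitrary: k)
  case (Suc n)
  then obtain j where j: "k = Suc j" by (cases k) auto
  show ?case
  proof (cases "k = n")
    case False
    then have "n \<le> n choose k" using Suc by simp
    moreover have "0 < n choose j" using Suc.prems j by simp
    ultimately have "Suc n \<le> (n choose j) + (n choose k)" by linarith
    then show ?thesis by (simp add: j)
  qed simp
qed simp

section \<open>Token configurations and their moves\<close>

abbreviation subsets_of_card :: "'a set \<Rightarrow> nat \<Rightarrow> 'a set set" where
  "subsets_of_card V k \<equiv> {A. A \<subseteq> V \<and> card A = k}"

text \<open>Neither the ground set nor the number of tokens is fixed, so one relation serves all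
  vertex-deleted graphs and all \<open>k\<close>; \<open>rtrancl_on\<close> imposes the
  restriction.\<close>

definition token_moves :: "'a rel \<Rightarrow> 'a set rel" where
  "token_moves E = {(A, B). \<exists>a\<in>A. \<exists>b. b \<notin> A \<and> (a, b) \<in> E \<and> B = insert b (A - {a})}"

lemma token_movesI:
  "a \<in> A \<Longrightarrow> b \<notin> A \<Longrightarrow> (a, b) \<in> E \<Longrightarrow> (A, insert b (A - {a})) \<in> token_moves E"
  unfolding token_moves_def by blast

lemma token_moves_insert:
  assumes "(A, B) \<in> token_moves E" and "w \<notin> A" and "w \<notin> B"
  shows "(insert w A, insert w B) \<in> token_moves E"
proof -
  obtain a b where ab: "a \<in> A" "b \<notin> A" "(a, b) \<in> E" "B = insert b (A - {a})"
    using assms(1) unfolding token_moves_def by blast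
  then have "insert w B = insert b (insert w A - {a})" using assms(2) by auto
  then show ?thesis
    using token_movesI[of a "insert w A" b E] ab assms(3) by auto
qed

lemma subsets_of_card_move:
  assumes "finite V" and "A \<in> subsets_of_card V k" and "a \<in> A" and "b \<in> V" and "b \<notin> A"
  shows "insert b (A - {a}) \<in> subsets_of_card V k"
proof -
  have "finite A" using assms finite_subset by auto
  then show ?thesis using assms card_Suc_Diff1[of A a] by auto
qed

text \<open>Tokens are indistinguishable, so an occupied vertex on the walk does not block it: the
  token there goes ahead and is replaced from behind. The induction keeps \<open>A\<close> arbitrary
  because this exchange changes the configuration first.\<close>

lemma token_moves_along_walk:
  assumes "(a, b) \<in> rtrancl_on V E" and "finite V"
    and "A \<in> subsets_of_card V k" and "a \<in> A" and "b \<notin> A"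
  shows "(A, insert b (A - {a})) \<in> rtrancl_on (subsets_of_card V k) (token_moves E)"
  using assms(1,3-)
proof (induct arbitrary: A rule: rtrancl_on_induct)
  case (step c b)
  show ?case
  proof (cases "c \<in> A")
    case True
    \<comment> \<open>The token on \<open>c\<close> moves on to \<open>b\<close> first; the token on \<open>a\<close> then takes the vacant \<open>c\<close>.\<close>
    let ?A = "insert b (A - {c})"
    have mv: "(A, ?A) \<in> token_moves E" using True step by (intro token_movesI)
    have A': "?A \<in> subsets_of_card V k"
      using subsets_of_card_move[OF \<open>finite V\<close>] step True by blast
    show ?thesis
    proof (cases "c = a")
      case True
      then show ?thesis using mv A' step.prems rtrancl_on_into_rtrancl_on rtrancl_on_refl
        by metis
    next
      case False
      have "c \<noteq> b" using True step.prems by blast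
      then have "(?A, insert c (?A - {a})) \<in> rtrancl_on (subsets_of_card V k) (token_moves E)"
        using step.hyps(5)[OF A'] False step.prems by auto
      moreover have "insert c (?A - {a}) = insert b (A - {a})"
        using True False step.prems by auto
      ultimately show ?thesis
        using mv step.prems converse_rtrancl_on_into_rtrancl_on by metis
    qed
  next
    case False
    let ?A = "insert c (A - {a})"
    have A': "(A, ?A) \<in> rtrancl_on (subsets_of_card V k) (token_moves E)"
      using step.hyps(5) step.prems False by blast
    show ?thesis
    \<comment> \<open>\<open>E\<close> is an arbitrary relation, so the last step of the walk may be
      a loop.\<close>
    proof (cases "b = c")
      case True
      then show ?thesis using A' by simp
    next
      case False
      have eq: "insert b (?A - {c}) = insert b (A - {a})"
        using \<open>c \<notin> A\<close> by auto
      have "(?A, insert b (?A - {c})) \<in> token_moves E"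
        by (rule token_movesI) (use step False in auto)
      moreover have "insert b (A - {a}) \<in> subsets_of_card V k"
        using subsets_of_card_move[OF \<open>finite V\<close>] step by blast
      ultimately show ?thesis
        unfolding eq by (rule rtrancl_on_into_rtrancl_on[OF A'])
    qed
  qed
qed simp

text \<open>Sets of equal size that differ have some \<open>a\<close> in \<open>A - B\<close> and
  some \<open>b\<close> in \<open>B - A\<close>; carrying the token from \<open>a\<close> to
  \<open>b\<close> lowers \<open>card (A - B)\<close>.\<close>

lemma token_moves_connected:
  assumes "finite V" and "\<And>a b. a \<in> V \<Longrightarrow> b \<in> V \<Longrightarrow> (a, b) \<in> rtrancl_on V E"
    and "A \<in> subsets_of_card V k" and "B \<in> subsets_of_card V k"
  shows "(A, B) \<in> rtrancl_on (subsets_of_card V k) (token_moves E)"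
  using assms(3)
proof (induct "card (A - B)" arbitrary: A rule: less_induct)
  case less
  have fin: "finite A" "finite B"
    using less.prems assms finite_subset[OF _ \<open>finite V\<close>] by auto
  show ?case
  proof (cases "A = B")
    case True
    then show ?thesis using less.prems by simp
  next
    case False
    have "card A = card B" using less.prems assms(4) by simp
    with False fin obtain a b where ab: "a \<in> A" "a \<notin> B" "b \<in> B" "b \<notin> A"
      by (metis card_subset_eq subsetI)
    let ?A = "insert b (A - {a})"
    have "?A - B = (A - B) - {a}" using ab by auto
    then have "card (?A - B) < card (A - B)"
      using ab fin by (metis DiffI card_Diff1_less finite_Diff)
    moreover have "?A \<in> subsets_of_card V k"
      using subsets_of_card_move[OF \<open>finite V\<close> less.prems] ab assms(4) by blast
    ultimately have "(?A, B) \<in> rtrancl_on (subsets_of_card V k) (token_moves E)"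
      by (rule less.hyps)
    moreover have "(A, ?A) \<in> rtrancl_on (subsets_of_card V k) (token_moves E)"
      using token_moves_along_walk[OF assms(2) \<open>finite V\<close>] ab less.prems assms(4) by blast
    ultimately show ?thesis by (rule rtrancl_on_trans[rotated])
  qed
qed

section \<open>Connectivity after deleting configurations\<close>

lemma ex_in_diff_of_card_eq:
  assumes "A \<in> subsets_of_card V k" and "B \<in> subsets_of_card V k" and "finite V" and "A \<noteq> B"
  shows "\<exists>x. x \<in> A \<and> x \<notin> B"
proof -
  have "finite A" "finite B" using assms finite_subset[OF _ \<open>finite V\<close>] by auto
  then show ?thesis using assms card_subset_eq[of B A] by auto
qed

text \<open>Stated for a set \<open>V\<close> and a relation \<open>E\<close>, so that the induction
  passes to \<open>V - {v}\<close> and \<open>V - {w}\<close> without forming new graphs. No bounds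
  are put on \<open>k\<close>, since these steps may leave no token at all or no vacant
  vertex.\<close>

lemma token_moves_connected_diff:
  assumes "finite V" and "t < card V"
    and "\<And>X a b. X \<subseteq> V \<Longrightarrow> card X < t \<Longrightarrow> a \<in> V - X \<Longrightarrow> b \<in> V - X \<Longrightarrow>
      (a, b) \<in> rtrancl_on (V - X) E"
    and "S \<subseteq> subsets_of_card V k" and "card S < t"
    and "A \<in> subsets_of_card V k - S" and "B \<in> subsets_of_card V k - S"
  shows "(A, B) \<in> rtrancl_on (subsets_of_card V k - S) (token_moves E)"
  using assms
proof (induct t arbitrary: V k S A B)
  case (Suc t)
  note finV = \<open>finite V\<close>
  have finS: "finite S" using Suc.prems(4) finV by (auto intro: finite_subset[of _ "Pow V"])
  have fin: "finite Y" if "Y \<subseteq> V" for Y using that finV by (rule finite_subset)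
  show ?case
  proof (cases "S = {}")
    case True
    have "(a, b) \<in> rtrancl_on V E" if "a \<in> V" "b \<in> V" for a b
      using Suc.prems(3)[of "{}"] that by simp
    then show ?thesis
      using token_moves_connected[OF finV, of E A k B] Suc.prems(6,7) True by auto
  next
    case False
    then obtain X where X: "X \<in> S" by blast
    then have XK: "X \<in> subsets_of_card V k" using Suc.prems(4) by blast
    have "A \<noteq> X" "B \<noteq> X" using X Suc.prems by auto
    then obtain v w where v: "v \<in> X" "v \<notin> A" and w: "w \<in> B" "w \<notin> X"
      using ex_in_diff_of_card_eq[OF XK _ finV] ex_in_diff_of_card_eq[OF _ XK finV] Suc.prems(6,7)
      by (metis DiffD1)
    have vV: "v \<in> V" and wV: "w \<in> V" and vw: "v \<noteq> w"
      using v w XK Suc.prems(7) by auto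
    have conn: "(a, b) \<in> rtrancl_on (V - {x} - Y) E"
      if "x \<in> V" "Y \<subseteq> V - {x}" "card Y < t" "a \<in> V - {x} - Y" "b \<in> V - {x} - Y" for x Y a b
    proof -
      have "card (insert x Y) < Suc t"
        using that fin[of Y] by (metis Diff_iff Suc_mono card_insert_disjoint insertI1 subset_iff)
      moreover have "V - {x} - Y = V - insert x Y" by auto
      ultimately show ?thesis using Suc.prems(3)[of "insert x Y" a b] that by auto
    qed
    have card_del: "t < card (V - {x})" if "x \<in> V" for x
      using that Suc.prems(2) finV by simp
    have cardSX: "card (S - {X}) < t"
      using card_Suc_Diff1[OF finS X] Suc.prems(5) by linarith

    have avoid: "(A, D) \<in> rtrancl_on (subsets_of_card V k - S) (token_moves E)"
      if D: "D \<in> subsets_of_card V k - S" "v \<notin> D" for D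
    proof -
      let ?S = "{Y \<in> S. v \<notin> Y}"
      have "?S \<subseteq> S - {X}" using v by blast
      then have "card ?S < t" using cardSX finS by (meson card_mono finite_Diff le_less_trans)
      then have "(A, D) \<in> rtrancl_on (subsets_of_card (V - {v}) k - ?S) (token_moves E)"
        using Suc.hyps[OF _ card_del[OF vV] conn[OF vV], of ?S k A D] finV Suc.prems(4,6) D v
        by auto
      then show ?thesis
        by (rule rtrancl_on_mono[rotated 2]) auto
    qed

    have contain: "(D, B) \<in> rtrancl_on (subsets_of_card V k - S) (token_moves E)"
      if D: "D \<in> subsets_of_card V k - S" "w \<in> D" for D
    proof -
      \<comment> \<open>The token on \<open>w\<close> stays put: deleting \<open>w\<close> leaves
        \<open>k - 1\<close> tokens on \<open>V - {w}\<close>, and the walk found there is lifted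
        back by \<open>insert w\<close>.\<close>
      let ?S = "(\<lambda>Y. Y - {w}) ` {Y \<in> S. w \<in> Y}"
      have "{Y \<in> S. w \<in> Y} \<subseteq> S - {X}" using w by blast
      then have "card {Y \<in> S. w \<in> Y} < t"
        using cardSX finS by (meson card_mono finite_Diff le_less_trans)
      then have cS: "card ?S < t"
        using card_image_le[of "{Y \<in> S. w \<in> Y}" "\<lambda>Y. Y - {w}"] finS by simp
      have del: "Y - {w} \<in> subsets_of_card (V - {w}) (k - 1)"
        if "Y \<in> subsets_of_card V k" "w \<in> Y" for Y
        using that fin by auto
      have sub: "?S \<subseteq> subsets_of_card (V - {w}) (k - 1)"
        by (intro image_subsetI del) (use Suc.prems(4) in auto)
      have notin: "Y - {w} \<notin> ?S" if "Y \<notin> S" "w \<in> Y" for Y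
        using that by (metis (no_types, lifting) imageE insert_Diff mem_Collect_eq)
      have "D - {w} \<in> subsets_of_card (V - {w}) (k - 1) - ?S"
        using del[of D] notin[of D] D by simp
      moreover have "B - {w} \<in> subsets_of_card (V - {w}) (k - 1) - ?S"
        using del[of B] notin[of B] Suc.prems(7) w by simp
      ultimately have "(D - {w}, B - {w}) \<in>
          rtrancl_on (subsets_of_card (V - {w}) (k - 1) - ?S) (token_moves E)"
        using Suc.hyps[OF _ card_del[OF wV] conn[OF wV] sub cS] finV by simp
      moreover have "insert w Y \<in> subsets_of_card V k - S"
        if Y: "Y \<in> subsets_of_card (V - {w}) (k - 1) - ?S" for Y
      proof -
        \<comment> \<open>\<open>D\<close> contains \<open>w\<close>, so the truncated
          \<open>k - 1\<close> is a true predecessor.\<close>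
        have "k > 0" using D fin by (auto simp: card_gt_0_iff)
        moreover have "w \<notin> Y" "finite Y" using Y fin by auto
        moreover have "insert w Y \<notin> S"
        proof
          assume "insert w Y \<in> S"
          then have "insert w Y - {w} \<in> ?S" by blast
          then show False using Y \<open>w \<notin> Y\<close> by simp
        qed
        ultimately show ?thesis using Y wV by auto
      qed
      ultimately have "(insert w (D - {w}), insert w (B - {w})) \<in>
          rtrancl_on (subsets_of_card V k - S) (token_moves E)"
        by (rule rtrancl_on_map) (auto intro: token_moves_insert)
      then show ?thesis using D w by (simp add: insert_absorb)
    qed

    have "\<exists>C \<in> subsets_of_card V k - S. v \<notin> C \<and> w \<in> C"
    \<comment> \<open>If \<open>v\<close> is not in \<open>B\<close>, take \<open>B\<close> itself;
      if \<open>w\<close> is in \<open>A\<close>, take \<open>A\<close>. Otherwise \<open>B\<close>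
      contains both \<open>v\<close> and \<open>w\<close> while \<open>A\<close> avoids both, which
      forces \<open>2 <= k <= card V - 2\<close> and so makes the binomial bound available.\<close>
    proof (cases "v \<notin> B \<or> w \<in> A")
      case True
      then show ?thesis using v w Suc.prems(6,7) by blast
    next
      case False
      let ?W = "V - {v, w}"
      let ?C = "insert w ` subsets_of_card ?W (k - 1)"
      have cW: "card ?W = card V - 2" using vV wV vw finV by simp
      have "card {v, w} \<le> card B" using False w Suc.prems(7) fin by (intro card_mono) auto
      then have k2: "2 \<le> k" using vw Suc.prems(7) by simp
      have "A \<subseteq> ?W" using False v Suc.prems(6) by auto
      then have "card A \<le> card ?W" using finV by (intro card_mono) auto
      then have kn: "k - 1 < card ?W" using k2 Suc.prems(6) by auto
      have "inj_on (insert w) (subsets_of_card ?W (k - 1))"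
        by (auto simp: inj_on_def)
      then have "card ?C = card ?W choose (k - 1)"
        using finV by (simp add: card_image n_subsets)
      then have "card ?W \<le> card ?C" using le_binomial[of "k - 1" "card ?W"] k2 kn by simp
      \<comment> \<open>\<open>Suc t < card V\<close> gives just \<open>t <= card V - 2\<close>, and
        \<open>S - {X}\<close> has fewer than \<open>t\<close> members.\<close>
      then have "t \<le> card ?C" using cW Suc.prems(2) by simp
      then have "\<not> ?C \<subseteq> S - {X}"
        using cardSX finS by (meson card_mono finite_Diff leD le_trans)
      moreover have "X \<notin> ?C" using w by blast
      ultimately obtain C where C: "C \<in> ?C" "C \<notin> S" by blast
      then obtain Y where Y: "C = insert w Y" "Y \<subseteq> ?W" "card Y = k - 1" by blast
      then have "w \<notin> Y" "finite Y" using fin by auto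
      then have "C \<in> subsets_of_card V k" "v \<notin> C" "w \<in> C" using Y k2 wV vw by auto
      then show ?thesis using C(2) by (intro bexI[of _ C]) simp_all
    qed
    then obtain C where C: "C \<in> subsets_of_card V k - S" "v \<notin> C" "w \<in> C" by (elim bexE conjE)
    show ?thesis by (rule rtrancl_on_trans[OF avoid[OF C(1) C(2)] contain[OF C(1) C(3)]])
  qed
qed (simp only: not_less_zero)

section \<open>Transfer to the token graph\<close>

lemma token_moves_subset_arcs_ends:
  "token_moves (arcs_ends G) \<inter> verts (token_graph k G) \<times> verts (token_graph k G)
    \<subseteq> arcs_ends (token_graph k G)"
proof clarify
  fix A B
  assume "(A, B) \<in> token_moves (arcs_ends G)"
    and V: "A \<in> verts (token_graph k G)" "B \<in> verts (token_graph k G)"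
  then obtain a b where "a \<in> A" "b \<notin> A" "a \<rightarrow>\<^bsub>G\<^esub> b" and B: "B = insert b (A - {a})"
    unfolding token_moves_def by blast
  moreover from this have "sym_diff A B = {a, b}" by auto
  ultimately have "\<exists>a\<in>A. \<exists>b\<in>B. sym_diff A B = {a, b} \<and> a \<rightarrow>\<^bsub>G\<^esub> b" by blast
  then have "(A, B) \<in> arcs (token_graph k G)" using V by (simp add: token_graph_def)
  then have "arc_to_ends (token_graph k G) (A, B) \<in> arcs_ends (token_graph k G)"
    unfolding arcs_ends_def by (rule imageI)
  then show "A \<rightarrow>\<^bsub>token_graph k G\<^esub> B"
    by (simp add: arc_to_ends_def token_graph_def)
qed

theorem theorem5:
  fixes G :: "('a, 'b) pre_digraph" and t n k :: nat
  assumes "graph G"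
    and "t_connected t G"
    and "card (verts G) = n"
    and "k \<ge> 1"
    and "n \<ge> k + 1"
  shows "t_connected t (token_graph k G)"
proof -
  interpret graph G by fact
  let ?T = "token_graph k G"
  have vT: "verts ?T = subsets_of_card (verts G) k" by (simp add: token_graph_def)
  have tn: "t < card (verts G)" using assms(2) by (simp add: t_connected_def)
  have conn: "(a, b) \<in> rtrancl_on (verts G - X) (arcs_ends G)"
    if "X \<subseteq> verts G" "card X < t" "a \<in> verts G - X" "b \<in> verts G - X" for X a b
    using assms(2) that connected_induce_subgraph_iff[OF \<open>graph G\<close>, of "verts G - X"]
    by (auto simp: t_connected_def)
  have "card (verts ?T) = n choose k"
    using assms(3) by (simp add: vT n_subsets)
  \<comment> \<open>The bounds on \<open>k\<close> enter here, through
    \<open>n <= n choose k\<close>; the resulting size also keeps \<open>S\<close> from exhausting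
    the vertices.\<close>
  then have size: "t < card (verts ?T)"
    using le_binomial[of k n] assms tn by linarith
  have "Digraph_Component.connected (?T \<restriction> (verts ?T - S))"
    if S: "S \<subseteq> verts ?T" "card S < t" for S
  proof -
    let ?W = "verts ?T - S"
    have "?W \<noteq> {}"
    proof
      assume "?W = {}"
      then have "S = verts ?T" using S by blast
      then show False using S(2) size by simp
    qed
    moreover have "(A, B) \<in> rtrancl_on ?W (arcs_ends ?T)" if "A \<in> ?W" "B \<in> ?W" for A B
    proof -
      have "(A, B) \<in> rtrancl_on ?W (token_moves (arcs_ends G))"
        using token_moves_connected_diff[OF finite_verts tn conn, of S k A B] S that
        unfolding vT by blast
      \<comment> \<open>Moves between arbitrary sets need not be arcs; cutting the relation down to
        \<open>?W\<close> makes the inclusion in the arcs of \<open>?T\<close> applicable.\<close>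
      then have "(A, B) \<in> rtrancl_on ?W (token_moves (arcs_ends G) \<inter> ?W \<times> ?W)"
        by (simp only: rtrancl_on_restrict)
      then show ?thesis
        by (rule rtrancl_on_mono[rotated 2]) (use token_moves_subset_arcs_ends in fast)+
    qed
    ultimately show ?thesis
      using connected_induce_subgraph_iff[OF graph_token_graph[OF \<open>graph G\<close>], of ?W k] by blast
  qed
  then show ?thesis using size by (simp add: t_connected_def)
qed

end
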